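(* Let $\mathbb{X}$ be a reflexive, smooth real Banach space and let $T \in \mathbb{K}(\mathbb{X})$. Then there exists $x \in S_{\mathbb{X}}$ such that $T$ preserves Birkhoff-James orthogonality at $x$, i.e., for any $y \in \mathbb{X}$, $x \perp_B y \Leftrightarrow Tx \perp_B Ty$.
   Context: $\mathbb{K}(\mathbb{X})$ is the space of compact linear operators on $\mathbb{X}$. $S_{\mathbb{X}} = \{x \in \mathbb{X} : \|x\| = 1\}$. For $x,y \in \mathbb{X}$, $x \perp_B y$ (Birkhoff-James orthogonality) means $\|x\| \le \|x + \lambda y\|$ for all $\lambda \in \mathbb{R}$. A Banach space is smooth if each point $x$ of its unit sphere has a unique norm-one functional $f$ with $f(x) = 1$.
   Formalization: The operator T is assumed to be nonzero; for T = 0 the claim fails, since then Tx ⊥_B Ty for all y, while a unit vector x is never Birkhoff-James orthogonal to itself (and if X = {0} the unit sphere is empty). *)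

theory Defs
  imports "HOL-Analysis.Analysis"
begin

definition bj_orthogonal :: "'a::real_normed_vector \<Rightarrow> 'a \<Rightarrow> bool" (infix "\<bottom>\<^sub>B" 50)
  where "x \<bottom>\<^sub>B y \<longleftrightarrow> (\<forall>c::real. norm x \<le> norm (x + c *\<^sub>R y))"

definition compact_operators :: "('a::real_normed_vector \<Rightarrow>\<^sub>L 'b::real_normed_vector) set"
  where "compact_operators = {T. compact (closure (blinfun_apply T ` cball 0 1))}"

lift_definition bidual_embedding ::
  "'a::real_normed_vector \<Rightarrow> (('a \<Rightarrow>\<^sub>L real) \<Rightarrow>\<^sub>L real)"
  is "\<lambda>x f. blinfun_apply f x"
  by (rule blinfun.bounded_linear_left)

definition reflexive_space :: "'a::real_normed_vector itself \<Rightarrow> bool"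
  where "reflexive_space _ \<longleftrightarrow>
    surj (bidual_embedding :: 'a \<Rightarrow> (('a \<Rightarrow>\<^sub>L real) \<Rightarrow>\<^sub>L real))"

definition smooth_space :: "'a::real_normed_vector itself \<Rightarrow> bool"
  where "smooth_space _ \<longleftrightarrow>
    (\<forall>x\<in>sphere (0::'a) 1. \<exists>!f::'a \<Rightarrow>\<^sub>L real. norm f = 1 \<and> blinfun_apply f x = 1)"

definition preserves_bj_orthogonality_at ::
  "('a::real_normed_vector \<Rightarrow>\<^sub>L 'b::real_normed_vector) \<Rightarrow> 'a \<Rightarrow> bool"
  where "preserves_bj_orthogonality_at T x \<longleftrightarrow>
    (\<forall>y. x \<bottom>\<^sub>B y \<longleftrightarrow> blinfun_apply T x \<bottom>\<^sub>B blinfun_apply T y)"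

end

theory Submission
  imports Defs
begin

text \<open>
  A compact operator on a reflexive space attains its norm at some unit vector \<open>x\<close>, and it is at
  such an \<open>x\<close> that orthogonality is preserved.

  If \<open>T x \<bottom>\<^sub>B T y\<close>, then \<open>\<parallel>T\<parallel> = \<parallel>T x\<parallel> \<le> \<parallel>T (x + c y)\<parallel> \<le> \<parallel>T\<parallel> \<parallel>x + c y\<parallel>\<close>, and dividing by \<open>\<parallel>T\<parallel>\<close> gives
  \<open>x \<bottom>\<^sub>B y\<close>. Conversely, by a theorem of James, \<open>x \<bottom>\<^sub>B y\<close> holds exactly when some norming functional
  of \<open>x\<close> (of norm at most one, with value \<open>\<parallel>x\<parallel>\<close> at \<open>x\<close>) vanishes at \<open>y\<close>. If \<open>g\<close> is a norming functional
  of \<open>T x\<close>, then \<open>(g \<circ> T) / \<parallel>T\<parallel>\<close> is one of \<open>x\<close>; by smoothness it is the one that vanishes at \<open>y\<close>. So \<open>g\<close> vanishes at \<open>T y\<close>, which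
  gives \<open>T x \<bottom>\<^sub>B T y\<close>.

  Norm attainment is reduced to functionals. By compactness the norm has a maximum on the closure
  of the image of the unit ball, at \<open>w\<close> say. If \<open>g\<close> is a norming functional of \<open>w\<close>, then
  \<open>g \<circ> T\<close> has the norm of \<open>T\<close>, and a point of the ball at which this functional attains its norm
  is also one at which \<open>T\<close> does. Every functional \<open>h\<close> attains its norm because a norming functional
  of \<open>h\<close> is, by reflexivity, the evaluation at a point.

  All functionals come from the Hahn-Banach theorem, in the form that every sublinear functional
  dominates a linear one.
\<close>

section \<open>Linear functionals below sublinear ones\<close>

text \<open>Homogeneity is required as an inequality only, since equality follows from it.\<close>

definition sublinear :: "('a::real_vector \<Rightarrow> real) \<Rightarrow> bool"
  where "sublinear p \<longleftrightarrow>
    (\<forall>x y. p (x + y) \<le> p x + p y) \<and> (\<forall>t x. 0 < t \<longrightarrow> p (t *\<^sub>R x) \<le> t * p x)"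

lemma sublinearI:
  assumes "\<And>x y. p (x + y) \<le> p x + p y" and "\<And>t x. 0 < t \<Longrightarrow> p (t *\<^sub>R x) \<le> t * p x"
  shows "sublinear p"
  using assms by (auto simp: sublinear_def)

lemma sublinear_add: "sublinear p \<Longrightarrow> p (x + y) \<le> p x + p y"
  by (simp add: sublinear_def)

text \<open>The inequality for \<open>1 / t\<close> is the reverse of the one for \<open>t\<close>.\<close>

lemma sublinear_scaleR:
  assumes "sublinear p" and "0 < t"
  shows "p (t *\<^sub>R x) = t * p x"
proof (rule antisym)
  show "p (t *\<^sub>R x) \<le> t * p x"
    using assms by (simp add: sublinear_def)
  have "p (inverse t *\<^sub>R (t *\<^sub>R x)) \<le> inverse t * p (t *\<^sub>R x)"
    using assms unfolding sublinear_def by (metis positive_imp_inverse_positive)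
  with assms(2) show "t * p x \<le> p (t *\<^sub>R x)"
    by (simp add: field_simps)
qed

lemma sublinear_zero:
  assumes "sublinear p"
  shows "p 0 = 0"
  using sublinear_scaleR[OF assms, of 2 0] by simp

lemma sublinear_minus_le:
  assumes "sublinear p"
  shows "- p (- x) \<le> p x"
  using sublinear_add[OF assms, of x "- x"] sublinear_zero[OF assms] by simp

text \<open>
  This is the one construction of new sublinear functionals that is used, for infima of chains as
  well as for infimal convolutions. A common bound of the family at each point makes the pointwise
  infimum meaningful, and subadditivity follows when any two members \<open>i\<close>, \<open>j\<close> have a third one
  below their sum; positive homogeneity likewise.
\<close>

lemma sublinear_INF:
  fixes Q :: "'i \<Rightarrow> 'a::real_vector \<Rightarrow> real"
  assumes "I \<noteq> {}"
    and bdd: "\<And>x. bdd_below ((\<lambda>i. Q i x) ` I)"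
    and add: "\<And>i j x y. i \<in> I \<Longrightarrow> j \<in> I \<Longrightarrow> \<exists>k\<in>I. Q k (x + y) \<le> Q i x + Q j y"
    and scale: "\<And>i t x. i \<in> I \<Longrightarrow> 0 < t \<Longrightarrow> \<exists>k\<in>I. Q k (t *\<^sub>R x) \<le> t * Q i x"
  shows "sublinear (\<lambda>x. INF i\<in>I. Q i x)"
proof (rule sublinearI)
  fix x y
  let ?q = "\<lambda>x. INF i\<in>I. Q i x"
  have le: "?q (x + y) \<le> Q i x + Q j y" if "i \<in> I" "j \<in> I" for i j
  proof -
    from add[OF that] obtain k where "k \<in> I" "Q k (x + y) \<le> Q i x + Q j y"
      by blast
    then show ?thesis
      using cINF_lower[OF bdd, of k "x + y"] by simp
  qed
  have "?q (x + y) - Q i x \<le> ?q y" if "i \<in> I" for i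
    using le[OF that] by (intro cINF_greatest[OF assms(1)]) (simp add: algebra_simps)
  then have "?q (x + y) - ?q y \<le> ?q x"
    by (intro cINF_greatest[OF assms(1)]) (simp add: algebra_simps)
  then show "?q (x + y) \<le> ?q x + ?q y"
    by simp
next
  fix t :: real and x :: 'a
  let ?q = "\<lambda>x. INF i\<in>I. Q i x"
  assume t: "0 < t"
  have "?q (t *\<^sub>R x) \<le> t * Q i x" if "i \<in> I" for i
  proof -
    from scale[OF that t] obtain k where "k \<in> I" "Q k (t *\<^sub>R x) \<le> t * Q i x"
      by blast
    then show ?thesis
      using cINF_lower[OF bdd, of k "t *\<^sub>R x"] by simp
  qed
  then have "?q (t *\<^sub>R x) / t \<le> ?q x"
    using t by (intro cINF_greatest[OF assms(1)]) (simp add: field_simps)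
  with t show "?q (t *\<^sub>R x) \<le> t * ?q x"
    by (simp add: field_simps)
qed

text \<open>
  For a fixed direction \<open>v\<close>, the functional \<open>x \<mapsto> inf {q (x + t v) - t q v | t \<ge> 0}\<close> is sublinear and
  lies below \<open>q\<close>. Minimality makes it equal to \<open>q\<close>, and \<open>t = 1\<close> then gives superadditivity.
\<close>

lemma minimal_sublinear_imp_linear:
  assumes q: "sublinear q"
    and minimal: "\<And>r. sublinear r \<Longrightarrow> (\<And>x. r x \<le> q x) \<Longrightarrow> r = q"
  shows "linear q"
proof -
  have add: "q (x + v) = q x + q v" for x v
  proof -
    define Q where "Q t z = q (z + t *\<^sub>R v) - t * q v" for t z
    define r where "r z = (INF t\<in>{0..}. Q t z)" for z
    have lower: "- q (- z) \<le> Q t z" if "t \<in> {0..}" for t z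
    proof -
      have "q (t *\<^sub>R v) = t * q v"
        using that sublinear_scaleR[OF q, of t v] sublinear_zero[OF q] by (cases "t = 0") auto
      moreover have "q (t *\<^sub>R v) \<le> q (z + t *\<^sub>R v) + q (- z)"
        using sublinear_add[OF q, of "z + t *\<^sub>R v" "- z"] by simp
      ultimately show ?thesis
        by (simp add: Q_def)
    qed
    have bdd: "bdd_below ((\<lambda>t. Q t z) ` {0..})" for z
      using lower by (rule bdd_belowI2)
    have "sublinear r"
      unfolding r_def
    proof (rule sublinear_INF[OF _ bdd])
      fix i j :: real and x y
      assume "i \<in> {0..}" "j \<in> {0..}"
      moreover have "Q (i + j) (x + y) \<le> Q i x + Q j y"
        using sublinear_add[OF q, of "x + i *\<^sub>R v" "y + j *\<^sub>R v"]
        by (simp add: Q_def algebra_simps)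
      ultimately show "\<exists>k\<in>{0..}. Q k (x + y) \<le> Q i x + Q j y"
        by (intro bexI[of _ "i + j"]) auto
    next
      fix i t :: real and x
      assume "i \<in> {0..}" "0 < t"
      moreover from this have "Q (t * i) (t *\<^sub>R x) \<le> t * Q i x"
        using sublinear_scaleR[OF q, of t "x + i *\<^sub>R v"]
        by (simp add: Q_def algebra_simps)
      ultimately show "\<exists>k\<in>{0..}. Q k (t *\<^sub>R x) \<le> t * Q i x"
        by (intro bexI[of _ "t * i"]) auto
    qed simp
    moreover have "r z \<le> q z" for z
      using cINF_lower[OF bdd, of 0 z] by (simp add: r_def Q_def)
    ultimately have "r = q"
      by (rule minimal)
    then have "q x \<le> Q 1 x"
      using cINF_lower[OF bdd, of 1 x] by (simp add: r_def fun_eq_iff)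
    then show ?thesis
      using sublinear_add[OF q, of x v] by (simp add: Q_def)
  qed
  have minus: "q (- x) = - q x" for x
    using add[of x "- x"] sublinear_zero[OF q] by simp
  show ?thesis
  proof (rule linearI)
    show "q (t *\<^sub>R x) = t *\<^sub>R q x" for t x
    proof (cases t "0::real" rule: linorder_cases)
      case less
      then show ?thesis
        using sublinear_scaleR[OF q, of "- t" x] minus[of "t *\<^sub>R x"] by simp
    next
      case equal
      then show ?thesis
        by (simp add: sublinear_zero[OF q])
    next
      case greater
      then show ?thesis
        by (simp add: sublinear_scaleR[OF q])
    qed
  qed (rule add)
qed

text \<open>
  Zorn's lemma yields a minimal sublinear functional below \<open>p\<close>. The members of a chain are bounded
  below at \<open>x\<close> by \<open>- p (- x)\<close>, so a chain has its pointwise infimum as a lower bound.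
\<close>

theorem hahn_banach_sublinear:
  assumes p: "sublinear p"
  obtains f where "linear f" and "\<And>x. f x \<le> p x"
proof -
  define A where "A = {q. sublinear q \<and> q \<le> p}"
  have "\<exists>m\<in>A. \<forall>q\<in>A. q \<le> m \<longrightarrow> q = m"
  proof (rule predicate_Zorn[where P = "\<lambda>x y. y \<le> x"])
    show "partial_order_on A (relation_of (\<lambda>x y. y \<le> x) A)"
      by (rule partial_order_on_relation_ofI) auto
  next
    fix C
    assume C: "C \<in> Chains (relation_of (\<lambda>x y. y \<le> x) A)"
    then have CA: "C \<subseteq> A"
      by (auto simp: Chains_def relation_of_def)
    have total: "a \<le> b \<or> b \<le> a" if "a \<in> C" "b \<in> C" for a b
      using C that by (auto simp: Chains_def relation_of_def)
    show "\<exists>u\<in>A. \<forall>a\<in>C. u \<le> a"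
    proof (cases "C = {}")
      case True
      then show ?thesis
        using p by (auto simp: A_def)
    next
      case False
      have sub: "sublinear a" "a x \<le> p x" if "a \<in> C" for a x
        using that CA by (auto simp: A_def le_fun_def)
      have bdd: "bdd_below ((\<lambda>a. a x) ` C)" for x
      proof (rule bdd_belowI2)
        fix a
        assume a: "a \<in> C"
        show "- p (- x) \<le> a x"
          using sublinear_minus_le[OF sub(1)[OF a], of x] sub(2)[OF a, of "- x"] by simp
      qed
      define u where "u x = (INF a\<in>C. a x)" for x
      have "sublinear u"
        unfolding u_def
      proof (rule sublinear_INF[OF False bdd])
        fix a b x y
        assume ab: "a \<in> C" "b \<in> C"
        \<comment> \<open>The smaller of \<open>a\<close> and \<open>b\<close> serves for both summands.\<close>
        from total[OF ab] show "\<exists>c\<in>C. c (x + y) \<le> a x + b y"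
        proof
          assume "a \<le> b"
          then have "a (x + y) \<le> a x + b y"
            using sublinear_add[OF sub(1)[OF ab(1)], of x y] le_funD[of a b y] by simp
          with ab show ?thesis by blast
        next
          assume "b \<le> a"
          then have "b (x + y) \<le> a x + b y"
            using sublinear_add[OF sub(1)[OF ab(2)], of x y] le_funD[of b a x] by simp
          with ab show ?thesis by blast
        qed
      next
        fix a x and t :: real
        assume "a \<in> C" "0 < t"
        then show "\<exists>c\<in>C. c (t *\<^sub>R x) \<le> t * a x"
          by (intro bexI[of _ a]) (simp_all add: sublinear_scaleR[OF sub(1)])
      qed
      moreover have below: "u \<le> a" if "a \<in> C" for a
        unfolding le_fun_def u_def using cINF_lower[OF bdd that] by blast
      moreover have "u \<le> p"
        using False below CA by (force simp: A_def)
      ultimately show ?thesis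
        by (auto simp: A_def)
    qed
  qed
  then obtain m where m: "sublinear m" "m \<le> p" and
    least: "\<And>q. sublinear q \<Longrightarrow> q \<le> p \<Longrightarrow> q \<le> m \<Longrightarrow> q = m"
    by (auto simp: A_def)
  have "linear m"
  proof (rule minimal_sublinear_imp_linear[OF m(1)])
    fix r
    assume r: "sublinear r" "\<And>x. r x \<le> m x"
    then have "r \<le> m"
      by (simp add: le_fun_def)
    with r(1) m(2) show "r = m"
      by (intro least) auto
  qed
  with m(2) show ?thesis
    by (intro that[of m]) (auto simp: le_fun_def)
qed

section \<open>Supporting functionals and orthogonality\<close>

text \<open>
  Such a functional is any linear one below
  \<open>z \<mapsto> inf {\<parallel>z - a x - b y\<parallel> + a \<parallel>x\<parallel> | a, b \<in> \<real>}\<close>, the largest sublinear functional that lies below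
  the norm, is at most \<open>\<plusminus>\<parallel>x\<parallel>\<close> at \<open>\<plusminus>x\<close> and at most \<open>0\<close> at \<open>\<plusminus>y\<close>. The infimum is finite because
  orthogonality says precisely that \<open>a \<parallel>x\<parallel> \<le> \<parallel>a x + b y\<parallel>\<close> for all \<open>a\<close> and \<open>b\<close>.
\<close>

lemma bj_orthogonal_imp_supporting_functional:
  fixes x y :: "'a::real_normed_vector"
  assumes "x \<bottom>\<^sub>B y"
  obtains f :: "'a \<Rightarrow>\<^sub>L real" where "norm f \<le> 1" and "f x = norm x" and "f y = 0"
proof -
  have orth: "a * norm x \<le> norm (a *\<^sub>R x + b *\<^sub>R y)" for a b
  proof (cases "0 < a")
    case True
    have "norm x \<le> norm (x + (b / a) *\<^sub>R y)"
      using assms by (simp add: bj_orthogonal_def)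
    then have "a * norm x \<le> norm (a *\<^sub>R (x + (b / a) *\<^sub>R y))"
      using True by simp
    with True show ?thesis
      by (simp add: scaleR_add_right)
  next
    case False
    then have "a * norm x \<le> 0"
      by (simp add: mult_nonpos_nonneg)
    then show ?thesis
      using norm_ge_zero order_trans by blast
  qed
  define Q where "Q = (\<lambda>(a, b) z. norm (z - a *\<^sub>R x - b *\<^sub>R y) + a * norm x)"
  define p where "p z = (INF c\<in>UNIV. Q c z)" for z
  have lower: "- norm z \<le> Q c z" for c z
  proof -
    obtain a b where c: "c = (a, b)"
      by fastforce
    have "norm ((- a) *\<^sub>R x + (- b) *\<^sub>R y) \<le> norm (z - a *\<^sub>R x - b *\<^sub>R y) + norm z"
      using norm_triangle_ineq4[of "z - a *\<^sub>R x - b *\<^sub>R y" z] by (simp add: algebra_simps)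
    then show ?thesis
      using orth[of "- a" "- b"] by (simp add: Q_def c)
  qed
  have bdd: "bdd_below (range (\<lambda>c. Q c z))" for z
    using lower by (rule bdd_belowI2)
  have "sublinear p"
    unfolding p_def
  proof (rule sublinear_INF[OF _ bdd])
    fix c d :: "real \<times> real" and u v
    have "Q (c + d) (u + v) \<le> Q c u + Q d v"
      using norm_triangle_ineq[of "u - fst c *\<^sub>R x - snd c *\<^sub>R y" "v - fst d *\<^sub>R x - snd d *\<^sub>R y"]
      by (simp add: Q_def case_prod_unfold algebra_simps)
    then show "\<exists>k\<in>UNIV. Q k (u + v) \<le> Q c u + Q d v"
      by blast
  next
    fix c :: "real \<times> real" and t :: real and u
    assume t: "0 < t"
    have "norm (t *\<^sub>R (u - fst c *\<^sub>R x - snd c *\<^sub>R y)) = t * norm (u - fst c *\<^sub>R x - snd c *\<^sub>R y)"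
      using t by simp
    then have "Q (t *\<^sub>R c) (t *\<^sub>R u) \<le> t * Q c u"
      by (simp add: Q_def case_prod_unfold algebra_simps)
    then show "\<exists>k\<in>UNIV. Q k (t *\<^sub>R u) \<le> t * Q c u"
      by blast
  qed simp
  then obtain f where f: "linear f" and fp: "\<And>z. f z \<le> p z"
    by (rule hahn_banach_sublinear) blast
  have fQ: "f z \<le> Q c z" for c z
    using fp[of z] cINF_lower[OF bdd, of c z] by (simp add: p_def)
  have le: "f z \<le> norm z" for z
    using fQ[of z "(0, 0)"] by (simp add: Q_def)
  have abs: "\<bar>f z\<bar> \<le> norm z" for z
    using le[of z] le[of "- z"] by (simp add: linear_neg[OF f])
  have fx: "f x = norm x"
    using fQ[of x "(1, 0)"] fQ[of "- x" "(-1, 0)"] by (simp add: Q_def linear_neg[OF f])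
  have fy: "f y = 0"
    using fQ[of y "(0, 1)"] fQ[of "- y" "(0, -1)"] by (simp add: Q_def linear_neg[OF f])
  have bl: "bounded_linear f"
    using f abs by (intro bounded_linear.intro bounded_linear_axioms.intro exI[of _ 1]) auto
  show ?thesis
  proof (rule that[of "Blinfun f"])
    show "norm (Blinfun f) \<le> 1"
      using abs by (intro norm_blinfun_bound) (simp_all add: bounded_linear_Blinfun_apply[OF bl])
  qed (simp_all add: bounded_linear_Blinfun_apply[OF bl] fx fy)
qed

text \<open>Every vector is orthogonal to \<open>0\<close>.\<close>

corollary norming_functional:
  fixes x :: "'a::real_normed_vector"
  obtains f :: "'a \<Rightarrow>\<^sub>L real" where "norm f \<le> 1" and "f x = norm x"
  using bj_orthogonal_imp_supporting_functional[of x 0] by (auto simp: bj_orthogonal_def)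

lemma blinfun_apply_le_norm:
  fixes f :: "'a::real_normed_vector \<Rightarrow>\<^sub>L real"
  assumes "norm f \<le> 1"
  shows "f x \<le> norm x"
proof -
  have "norm (f x) \<le> norm f * norm x"
    by (rule norm_blinfun)
  also have "\<dots> \<le> norm x"
    using assms by (simp add: mult_left_le_one_le)
  finally show ?thesis
    by simp
qed

lemma supporting_functional_imp_bj_orthogonal:
  fixes f :: "'a::real_normed_vector \<Rightarrow>\<^sub>L real"
  assumes "norm f \<le> 1" and "f x = norm x" and "f y = 0"
  shows "x \<bottom>\<^sub>B y"
  unfolding bj_orthogonal_def
proof
  fix c
  show "norm x \<le> norm (x + c *\<^sub>R y)"
    using blinfun_apply_le_norm[OF assms(1), of "x + c *\<^sub>R y"] assms(2,3)
    by (simp add: blinfun.add_right blinfun.scaleR_right)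
qed

lemma smooth_space_supporting_functional_unique:
  fixes f g :: "'a::real_normed_vector \<Rightarrow>\<^sub>L real"
  assumes "smooth_space TYPE('a)" and x: "norm x = 1"
    and f: "norm f \<le> 1" "f x = 1" and g: "norm g \<le> 1" "g x = 1"
  shows "f = g"
proof -
  have norm1: "norm h = 1" if "norm h \<le> 1" "h x = 1" for h :: "'a \<Rightarrow>\<^sub>L real"
    using norm_blinfun[of h x] that x by simp
  show ?thesis
    using assms(1) x f(2) g(2) norm1[OF f] norm1[OF g]
    unfolding smooth_space_def by (metis mem_sphere_0)
qed

section \<open>Norm attainment\<close>

text \<open>
  A norming functional of \<open>h\<close> in the bidual is the evaluation at some \<open>x\<close>. That \<open>x\<close> lies in the unit
  ball is seen by evaluating at a norming functional of \<open>x\<close>.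
\<close>

lemma reflexive_functional_attains_norm:
  fixes h :: "'a::real_normed_vector \<Rightarrow>\<^sub>L real"
  assumes "reflexive_space TYPE('a)"
  obtains x where "norm x \<le> 1" and "h x = norm h"
proof -
  obtain F :: "('a \<Rightarrow>\<^sub>L real) \<Rightarrow>\<^sub>L real" where F: "norm F \<le> 1" "F h = norm h"
    by (rule norming_functional)
  obtain x where x: "F = bidual_embedding x"
    using assms unfolding reflexive_space_def surj_def by blast
  obtain f :: "'a \<Rightarrow>\<^sub>L real" where f: "norm f \<le> 1" "f x = norm x"
    by (rule norming_functional)
  have "norm x = F f"
    by (simp add: x bidual_embedding.rep_eq f(2))
  also have "\<dots> \<le> norm f"
    by (rule blinfun_apply_le_norm[OF F(1)])
  finally have "norm x \<le> 1"
    using f(1) by simp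
  moreover have "h x = norm h"
    using F(2) by (simp add: x bidual_embedding.rep_eq)
  ultimately show ?thesis
    by (rule that)
qed

text \<open>
  The point \<open>w\<close> of largest norm in the closure of the image of the ball need not be an image itself.
  But the bound \<open>\<parallel>g \<circ> T\<parallel>\<close> for \<open>g\<close> on the image extends to the closure, so
  \<open>\<parallel>T\<parallel> \<le> \<parallel>w\<parallel> = g w \<le> \<parallel>g \<circ> T\<parallel>\<close>, and \<open>T\<close> attains its norm wherever \<open>g \<circ> T\<close> does.
\<close>

lemma compact_operator_attains_norm:
  fixes T :: "'a::real_normed_vector \<Rightarrow>\<^sub>L 'b::real_normed_vector"
  assumes "reflexive_space TYPE('a)" and "T \<in> compact_operators" and "T \<noteq> 0"
  obtains x where "norm x = 1" and "norm (T x) = norm T"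
proof -
  let ?K = "closure (T ` cball 0 1)"
  have "compact ?K"
    using assms(2) by (simp add: compact_operators_def)
  then obtain w where w: "w \<in> ?K" and max: "\<And>u. u \<in> ?K \<Longrightarrow> norm u \<le> norm w"
    using continuous_attains_sup[of ?K norm] by (auto intro: continuous_intros)
  have "norm T \<le> norm w"
  proof (rule norm_blinfun_bound)
    fix z
    show "norm (T z) \<le> norm w * norm z"
    proof (cases "z = 0")
      case False
      have "T (inverse (norm z) *\<^sub>R z) \<in> ?K"
        using False by (intro closure_subset[THEN subsetD] imageI) simp
      then have "norm (T (inverse (norm z) *\<^sub>R z)) \<le> norm w"
        by (rule max)
      with False show ?thesis
        by (simp add: blinfun.scaleR_right field_simps)
    qed simp
  qed simp
  obtain g :: "'b \<Rightarrow>\<^sub>L real" where g: "norm g \<le> 1" "g w = norm w"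
    by (rule norming_functional)
  define h where "h = g o\<^sub>L T"
  have "?K \<subseteq> {u. g u \<le> norm h}"
  proof (rule closure_minimal)
    show "T ` cball 0 1 \<subseteq> {u. g u \<le> norm h}"
    proof clarsimp
      fix z :: 'a
      assume "norm z \<le> 1"
      have "g (T z) \<le> norm h * norm z"
        using norm_blinfun[of h z] by (simp add: h_def)
      also have "\<dots> \<le> norm h"
        using \<open>norm z \<le> 1\<close> by (simp add: mult_left_le)
      finally show "g (T z) \<le> norm h" .
    qed
    show "closed {u. g u \<le> norm h}"
      by (intro closed_Collect_le continuous_intros)
  qed
  with w g(2) have "norm w \<le> norm h"
    by auto
  obtain x where x: "norm x \<le> 1" "h x = norm h"
    using reflexive_functional_attains_norm[OF assms(1)] .
  have "norm T \<le> h x"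
    using \<open>norm T \<le> norm w\<close> \<open>norm w \<le> norm h\<close> x(2) by simp
  also have "\<dots> \<le> norm (T x)"
    using blinfun_apply_le_norm[OF g(1)] by (simp add: h_def)
  finally have ge: "norm T \<le> norm (T x)" .
  have le: "norm (T x) \<le> norm T * norm x"
    by (rule norm_blinfun)
  have "norm T * 1 \<le> norm T * norm x"
    using ge le by simp
  then have "norm x = 1"
    using assms(3) x(1) by (simp add: mult_le_cancel_left_pos)
  moreover have "norm (T x) = norm T"
    using ge le \<open>norm x = 1\<close> by simp
  ultimately show ?thesis
    by (rule that)
qed

section \<open>Preservation of orthogonality\<close>

text \<open>The norm of \<open>T\<close> is attained on the left of the inequality and bounds it on the right, so it cancels.\<close>

lemma norm_attaining_reflects_bj_orthogonality:
  fixes T :: "'a::real_normed_vector \<Rightarrow>\<^sub>L 'b::real_normed_vector"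
  assumes "T \<noteq> 0" and "norm (T x) = norm T * norm x" and "T x \<bottom>\<^sub>B T y"
  shows "x \<bottom>\<^sub>B y"
  unfolding bj_orthogonal_def
proof
  fix c
  have "norm T * norm x \<le> norm (T (x + c *\<^sub>R y))"
    using assms(2,3) by (simp add: bj_orthogonal_def blinfun.add_right blinfun.scaleR_right)
  also have "\<dots> \<le> norm T * norm (x + c *\<^sub>R y)"
    by (rule norm_blinfun)
  finally show "norm x \<le> norm (x + c *\<^sub>R y)"
    using assms(1) by simp
qed

text \<open>
  Pulling a norming functional \<open>g\<close> of \<open>T x\<close> back along \<open>T\<close> gives, after division by \<open>\<parallel>T\<parallel>\<close>, a norming
  functional of \<open>x\<close>, because \<open>\<parallel>T x\<parallel> = \<parallel>T\<parallel>\<close>. Smoothness identifies it with the one that orthogonality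
  provides, so any choice of \<open>g\<close> vanishes at \<open>T y\<close>.
\<close>

lemma norm_attaining_preserves_bj_orthogonality:
  fixes T :: "'a::real_normed_vector \<Rightarrow>\<^sub>L 'b::real_normed_vector"
  assumes smooth: "smooth_space TYPE('a)" and "T \<noteq> 0"
    and x: "norm x = 1" "norm (T x) = norm T" and orth: "x \<bottom>\<^sub>B y"
  shows "T x \<bottom>\<^sub>B T y"
proof -
  obtain f :: "'a \<Rightarrow>\<^sub>L real" where f: "norm f \<le> 1" "f x = norm x" "f y = 0"
    using bj_orthogonal_imp_supporting_functional[OF orth] .
  obtain g :: "'b \<Rightarrow>\<^sub>L real" where g: "norm g \<le> 1" "g (T x) = norm (T x)"
    by (rule norming_functional)
  define h where "h = inverse (norm T) *\<^sub>R (g o\<^sub>L T)"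
  have "norm (g o\<^sub>L T) \<le> norm g * norm T"
    by (rule norm_blinfun_compose)
  also have "\<dots> \<le> norm T"
    using g(1) by (simp add: mult_left_le_one_le)
  finally have "norm h \<le> 1"
    using assms(2) by (simp add: h_def field_simps)
  moreover have "h x = 1"
    using assms(2) x g(2) by (simp add: h_def blinfun.scaleR_left)
  ultimately have "f = h"
    using f x(1) by (intro smooth_space_supporting_functional_unique[OF smooth x(1)]) auto
  then have "g (T y) = 0"
    using f(3) assms(2) by (simp add: h_def blinfun.scaleR_left)
  with g show ?thesis
    by (rule supporting_functional_imp_bj_orthogonal)
qed

theorem theorem2p4:
  fixes T :: "'a::banach \<Rightarrow>\<^sub>L 'a"
  assumes "reflexive_space TYPE('a)"
    and "smooth_space TYPE('a)"
    and "T \<in> compact_operators"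
    and "T \<noteq> 0"
  shows "\<exists>x\<in>sphere 0 1. preserves_bj_orthogonality_at T x"
proof -
  obtain x where x: "norm x = 1" "norm (T x) = norm T"
    using compact_operator_attains_norm[OF assms(1,3,4)] .
  have "preserves_bj_orthogonality_at T x"
    unfolding preserves_bj_orthogonality_at_def
    using norm_attaining_preserves_bj_orthogonality[OF assms(2,4) x]
      norm_attaining_reflects_bj_orthogonality[OF assms(4)] x by auto
  with x(1) show ?thesis
    by (intro bexI[of _ x]) simp_all
qed

end
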